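(* Let $\epsilon>0$, let $n,N,Q\ge1$ be integers, $L=\lceil\log_2 N\rceil$, $\epsilon'=\epsilon/(L+9)$. Let $\mathcal{X}$ be a space of instances, $\mathcal{M}:\mathcal{X}\to[0,1]$ a model (predicted probability of being positive) and $\mathcal{Y}:\mathcal{X}\to\{0,1\}$ the true class label. Let $0<\psi<1$ be a precision, and let $\tau_1<\dots<\tau_N$ be a fixed grid in $[0,1]$ containing all midpoints that bisection of $[0,1]$ with precision $\psi$ can query. Consider the randomized algorithm (private Hosmer-Lemeshow statistic) described in the context, which on input a dataset $X\in\mathcal{X}^n$ computes the noisy empirical cumulative distribution function $\hat F_{\mathcal{M}}(X,\cdot)$ on the grid, the thresholds $t_0,\dots,t_Q$, the noisy statistics $E_{s,q}$ and $O_{s,q}$ for $q\in\{1,\dots,Q\}$, $s\in\{0,1\}$, and the statistic $H$. Then running this algorithm and disclosing all of these results, i.e. publishing $$\left((\hat F_{\mathcal{M}}(X,\tau_i))_{i=1}^N,\ (t_q)_{q=0}^Q,\ (E_{s,q})_{s,q},\ (O_{s,q})_{s,q},\ H\right),$$ is $\epsilon$-differentially private.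
   Context: Differential privacy: two datasets in $\mathcal{X}^n$ are adjacent if they differ in only one element (one instance is replaced by another); a randomized algorithm $\mathcal{A}$ is $\epsilon$-differentially private if $P(\mathcal{A}(X^{(1)})\in S)\le e^{\epsilon}P(\mathcal{A}(X^{(2)})\in S)$ for all adjacent $X^{(1)},X^{(2)}$ and all measurable output sets $S$. $\mathrm{Lap}(b)$ is the centered Laplace distribution with density $\frac1{2b}e^{-|x|/b}$. Grid: let $K$ be the least non-negative integer with $2^{-K}\le\psi$; the grid $\{\tau_1,\dots,\tau_N\}$ contains all points $k2^{-K}$ with $0<k<2^K$. Algorithm on input $X=\{x_k\}_{k=1}^n$ (all noise variables below are mutually independent): (1) Noisy ECDF: with $\eta_{j,l}\sim\mathrm{Lap}(1/\epsilon')$ for $0\le l\le L$, $1\le j\le 2^{L-l}$, let $$\hat F_{\mathcal{M}}(X,\tau_i)=\frac1n|\{k:\mathcal{M}(x_k)\le\tau_i\}|+\frac1n\sum_{l=0}^L\eta_{\lceil i/2^l\rceil,l}.$$ (2) Thresholds: $t_0=0$, $t_Q=1$, and for $1\le q\le Q-1$, $t_q=\hat F_{\mathcal{M}}^{-1}(q/Q)$, where $\hat F_{\mathcal{M}}^{-1}(p)$ is the output of the following bisection: start with $a=0,b=1$; while $b-a>\psi$, let $m=(a+b)/2$, and if $\hat F_{\mathcal{M}}(X,m)<p$ set $a:=m$, otherwise set $b:=m$; return $(a+b)/2$. (3) Groups: the instances are partitioned into $Q$ groups: group $1$ consists of the $k$ with $t_0\le\mathcal{M}(x_k)\le t_1$,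 and for $q\ge2$ group $q$ consists of the $k$ with $t_{q-1}<\mathcal{M}(x_k)\le t_q$. (4) Noisy predicted and observed counts: for each $q\in\{1,\dots,Q\}$, $E_{1,q}=\sum_{k\in\text{group }q}\mathcal{M}(x_k)+\xi_{1,q}$, $E_{0,q}=\sum_{k\in\text{group }q}(1-\mathcal{M}(x_k))+\xi_{0,q}$, $O_{1,q}=\sum_{k\in\text{group }q}\mathcal{Y}(x_k)+\zeta_{1,q}$, $O_{0,q}=\sum_{k\in\text{group }q}(1-\mathcal{Y}(x_k))+\zeta_{0,q}$, where all $\xi_{s,q},\zeta_{s,q}\sim\mathrm{Lap}(1/\epsilon')$. (5) Statistic: $H=\sum_{q=1}^Q\left(\frac{(O_{1,q}-E_{1,q})^2}{E_{1,q}}+\frac{(O_{0,q}-E_{0,q})^2}{E_{0,q}}\right)$ (with the convention that a quotient with denominator $0$, a probability-zero event, is $0$). *)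

theory Defs
  imports "HOL-Probability.Probability" "HOL-Library.While_Combinator"
begin

section \<open>Differential privacy\<close>

text \<open>Datasets in \<open>\<X>\<^sup>n\<close> are lists of length \<open>n\<close>.\<close>

definition adjacent :: "'x list \<Rightarrow> 'x list \<Rightarrow> bool" where
  "adjacent X X' \<longleftrightarrow> length X = length X' \<and> (\<exists>!k. k < length X \<and> X ! k \<noteq> X' ! k)"

text \<open>
  A randomized algorithm is given by its output law \<open>A X\<close> on the measurable space \<open>Out\<close>.
  The first conjunct matters when \<open>A X\<close> is built with \<^const>\<open>distr\<close>: \<open>distr M N f\<close> is the zero
  measure when \<open>f\<close> is not measurable, and the inequality alone would then be trivial.
\<close>

definition differentially_private ::
    "real \<Rightarrow> 'd set \<Rightarrow> ('d \<Rightarrow> 'd \<Rightarrow> bool) \<Rightarrow> 'o measure \<Rightarrow> ('d \<Rightarrow> 'o measure) \<Rightarrow> bool" where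
  "differentially_private \<epsilon> D adj Out A \<longleftrightarrow>
     (\<forall>X\<in>D. prob_space (A X) \<and> sets (A X) = sets Out) \<and>
     (\<forall>X\<in>D. \<forall>X'\<in>D. adj X X' \<longrightarrow>
        (\<forall>S\<in>sets Out. measure (A X) S \<le> exp \<epsilon> * measure (A X') S))"

section \<open>Noise\<close>

definition laplace_density :: "real \<Rightarrow> real \<Rightarrow> real" where
  "laplace_density b x = 1 / (2 * b) * exp (- \<bar>x\<bar> / b)"

definition laplace :: "real \<Rightarrow> real measure" where
  "laplace b = density lborel (\<lambda>x. ennreal (laplace_density b x))"

text \<open>
  Labels of the noise variables: \<open>Eta j l\<close> is $\eta_{j,l}$, \<open>Xi s q\<close> is $\xi_{s,q}$ and
  \<open>Zeta s q\<close> is $\zeta_{s,q}$. A joint value of all the noise is a function on labels.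
\<close>

datatype noise_label = Eta nat nat | Xi nat nat | Zeta nat nat

definition noise_labels :: "nat \<Rightarrow> nat \<Rightarrow> noise_label set" where
  "noise_labels L Q =
     {Eta j l | j l. l \<le> L \<and> 1 \<le> j \<and> j \<le> 2 ^ (L - l)} \<union>
     {Xi s q | s q. s \<in> {0, 1} \<and> q \<in> {1..Q}} \<union>
     {Zeta s q | s q. s \<in> {0, 1} \<and> q \<in> {1..Q}}"

definition noise_measure :: "nat \<Rightarrow> nat \<Rightarrow> real \<Rightarrow> (noise_label \<Rightarrow> real) measure" where
  "noise_measure L Q b = Pi\<^sub>M (noise_labels L Q) (\<lambda>_. laplace b)"

section \<open>The private Hosmer-Lemeshow statistic\<close>

text \<open>
  Throughout, \<open>M\<close> is the model, \<open>Y\<close> the true label, \<open>X\<close> the dataset and \<open>w\<close> the noise value.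
\<close>

definition noisy_ecdf ::
    "('x \<Rightarrow> real) \<Rightarrow> (nat \<Rightarrow> real) \<Rightarrow> nat \<Rightarrow> 'x list \<Rightarrow> (noise_label \<Rightarrow> real) \<Rightarrow> nat \<Rightarrow> real" where
  "noisy_ecdf M \<tau> L X w i =
     1 / real (length X) * real (card {k. k < length X \<and> M (X ! k) \<le> \<tau> i}) +
     1 / real (length X) * (\<Sum>l=0..L. w (Eta (nat \<lceil>real i / 2 ^ l\<rceil>) l))"

definition bisection :: "real \<Rightarrow> (real \<Rightarrow> real) \<Rightarrow> real \<Rightarrow> real" where
  "bisection \<psi> F p =
     (let (a, b) = while (\<lambda>(a, b). b - a > \<psi>)
                     (\<lambda>(a, b). let m = (a + b) / 2 in if F m < p then (m, b) else (a, m))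
                     (0, 1)
      in (a + b) / 2)"

text \<open>The noisy ECDF as a function of a grid point \<open>m\<close> rather than of its index.\<close>

definition noisy_ecdf_at ::
    "('x \<Rightarrow> real) \<Rightarrow> (nat \<Rightarrow> real) \<Rightarrow> nat \<Rightarrow> nat \<Rightarrow> 'x list \<Rightarrow> (noise_label \<Rightarrow> real) \<Rightarrow> real \<Rightarrow> real"
  where
  "noisy_ecdf_at M \<tau> N L X w m = noisy_ecdf M \<tau> L X w (the_inv_into {1..N} \<tau> m)"

definition threshold ::
    "('x \<Rightarrow> real) \<Rightarrow> (nat \<Rightarrow> real) \<Rightarrow> nat \<Rightarrow> nat \<Rightarrow> nat \<Rightarrow> real \<Rightarrow> 'x list \<Rightarrow>
     (noise_label \<Rightarrow> real) \<Rightarrow> nat \<Rightarrow> real" where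
  "threshold M \<tau> N L Q \<psi> X w q =
     (if q = 0 then 0 else if q = Q then 1
      else bisection \<psi> (noisy_ecdf_at M \<tau> N L X w) (real q / real Q))"

text \<open>Positions (from \<open>0\<close>) of the instances in group \<open>q\<close>, for thresholds \<open>t\<close>.\<close>

definition group :: "('x \<Rightarrow> real) \<Rightarrow> (nat \<Rightarrow> real) \<Rightarrow> 'x list \<Rightarrow> nat \<Rightarrow> nat set" where
  "group M t X q =
     {k. k < length X \<and>
         (if q = 1 then t 0 \<le> M (X ! k) else t (q - 1) < M (X ! k)) \<and> M (X ! k) \<le> t q}"

definition predicted_count ::
    "('x \<Rightarrow> real) \<Rightarrow> (nat \<Rightarrow> real) \<Rightarrow> 'x list \<Rightarrow> (noise_label \<Rightarrow> real) \<Rightarrow> nat \<Rightarrow> nat \<Rightarrow> real" where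
  "predicted_count M t X w s q =
     (\<Sum>k\<in>group M t X q. if s = 1 then M (X ! k) else 1 - M (X ! k)) + w (Xi s q)"

definition observed_count ::
    "('x \<Rightarrow> real) \<Rightarrow> ('x \<Rightarrow> real) \<Rightarrow> (nat \<Rightarrow> real) \<Rightarrow> 'x list \<Rightarrow> (noise_label \<Rightarrow> real) \<Rightarrow>
     nat \<Rightarrow> nat \<Rightarrow> real" where
  "observed_count M Y t X w s q =
     (\<Sum>k\<in>group M t X q. if s = 1 then Y (X ! k) else 1 - Y (X ! k)) + w (Zeta s q)"

definition hl_statistic :: "nat \<Rightarrow> (nat \<Rightarrow> nat \<Rightarrow> real) \<Rightarrow> (nat \<Rightarrow> nat \<Rightarrow> real) \<Rightarrow> real" where
  "hl_statistic Q E Ob =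
     (\<Sum>q=1..Q. (Ob 1 q - E 1 q)\<^sup>2 / E 1 q + (Ob 0 q - E 0 q)\<^sup>2 / E 0 q)"

type_synonym hl_output =
  "(nat \<Rightarrow> real) \<times> (nat \<Rightarrow> real) \<times> (nat \<times> nat \<Rightarrow> real) \<times> (nat \<times> nat \<Rightarrow> real) \<times> real"

definition hl_output_space :: "nat \<Rightarrow> nat \<Rightarrow> hl_output measure" where
  "hl_output_space N Q =
     Pi\<^sub>M {1..N} (\<lambda>_. borel) \<Otimes>\<^sub>M Pi\<^sub>M {0..Q} (\<lambda>_. borel) \<Otimes>\<^sub>M
     Pi\<^sub>M ({0, 1} \<times> {1..Q}) (\<lambda>_. borel) \<Otimes>\<^sub>M Pi\<^sub>M ({0, 1} \<times> {1..Q}) (\<lambda>_. borel) \<Otimes>\<^sub>M borel"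

definition hl_output ::
    "('x \<Rightarrow> real) \<Rightarrow> ('x \<Rightarrow> real) \<Rightarrow> (nat \<Rightarrow> real) \<Rightarrow> nat \<Rightarrow> nat \<Rightarrow> nat \<Rightarrow> real \<Rightarrow> 'x list \<Rightarrow>
     (noise_label \<Rightarrow> real) \<Rightarrow> hl_output" where
  "hl_output M Y \<tau> N L Q \<psi> X w =
     (let t = threshold M \<tau> N L Q \<psi> X w;
          E = predicted_count M t X w;
          Ob = observed_count M Y t X w
      in (\<lambda>i\<in>{1..N}. noisy_ecdf M \<tau> L X w i,
          \<lambda>q\<in>{0..Q}. t q,
          \<lambda>(s, q)\<in>{0, 1} \<times> {1..Q}. E s q,
          \<lambda>(s, q)\<in>{0, 1} \<times> {1..Q}. Ob s q,
          hl_statistic Q E Ob))"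

definition private_hl ::
    "('x \<Rightarrow> real) \<Rightarrow> ('x \<Rightarrow> real) \<Rightarrow> (nat \<Rightarrow> real) \<Rightarrow> nat \<Rightarrow> nat \<Rightarrow> nat \<Rightarrow> real \<Rightarrow> real \<Rightarrow> 'x list \<Rightarrow>
     hl_output measure" where
  "private_hl M Y \<tau> N L Q \<psi> \<epsilon>' X =
     distr (noise_measure L Q (1 / \<epsilon>')) (hl_output_space N Q) (hl_output M Y \<tau> N L Q \<psi> X)"

end

theory Submission
  imports Defs
begin

text \<open>
  Two adjacent datasets are coupled by shifting the noise. The thresholds are part of the output
  and take finitely many values, so the output space splits into finitely many slices on which
  they are fixed. On one slice, adding a constant vector \<open>d\<close> to the noise of the second run
  reproduces the output of the first, and this costs a factor \<open>exp (\<epsilon>' * \<Sum>i. \<bar>d i\<bar>)\<close>. The tree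
  noise must absorb the difference of two suffix indicators on the grid; a signed dyadic
  decomposition of each has \<open>\<ell>\<^sub>1\<close> norm at most \<open>(L + 3) / 2\<close>. As the thresholds are monotone,
  the changed instance leaves one group and enters one group, so the predicted and the observed
  counts each cost at most \<open>2\<close>. In total \<open>(L + 3) + 4 \<le> L + 9\<close>.
\<close>

section \<open>Laplace noise\<close>

lemma laplace_density_nonneg: "0 < b \<Longrightarrow> 0 \<le> laplace_density b x"
  by (simp add: laplace_density_def)

lemma borel_measurable_laplace_density [measurable]: "laplace_density b \<in> borel_measurable borel"
  unfolding laplace_density_def[abs_def] by measurable

lemma sets_laplace [simp, measurable_cong]: "sets (laplace b) = sets borel"
  by (simp add: laplace_def)

lemma space_laplace [simp]: "space (laplace b) = UNIV"
  by (simp add: laplace_def)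

text \<open>The Laplace density is the average of the exponential density of rate
  \<open>1 / b\<close> and its reflection, so its total mass is inherited from the exponential
  law.\<close>

lemma prob_space_laplace:
  assumes "0 < b"
  shows "prob_space (laplace b)"
proof -
  define e where "e = (\<lambda>x. ennreal (exponential_density (1 / b) x))"
  have e [measurable]: "e \<in> borel_measurable borel"
    unfolding e_def by measurable
  have "prob_space (density lborel e)"
    unfolding e_def using assms by (intro prob_space_exponential_density) simp
  then have int_e: "(\<integral>\<^sup>+x. e x \<partial>lborel) = 1"
    using prob_space.emeasure_space_1 by (fastforce simp: emeasure_density)
  have int_e': "(\<integral>\<^sup>+x. e (- x) \<partial>lborel) = 1"
    using nn_integral_real_affine[OF e, of "-1" 0] int_e by simp
  \<comment> \<open>At \<open>0\<close> both the exponential density and its reflection equal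
    \<open>1 / b\<close>, so their average is twice the Laplace density there; the identity is only
    used almost everywhere.\<close>
  have "AE x in lborel. x \<noteq> (0 :: real)"
    by (rule AE_lborel_singleton)
  then have "(\<integral>\<^sup>+x. ennreal (laplace_density b x) \<partial>lborel)
      = (\<integral>\<^sup>+x. ennreal (1 / 2) * (e x + e (- x)) \<partial>lborel)"
  proof (intro nn_integral_cong_AE, eventually_elim)
    fix x :: real assume "x \<noteq> 0"
    then have "laplace_density b x =
        1 / 2 * (exponential_density (1 / b) x + exponential_density (1 / b) (- x))"
      by (auto simp: laplace_density_def exponential_density_def)
    then show "ennreal (laplace_density b x) = ennreal (1 / 2) * (e x + e (- x))"
      using assms unfolding e_def
      by (simp only: ennreal_mult'[symmetric] ennreal_plus[symmetric] exponential_density_nonneg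
          add_nonneg_nonneg zero_less_divide_1_iff)
  qed
  also have "\<dots> = ennreal (1 / 2) * (1 + 1)"
    by (simp add: nn_integral_cmult nn_integral_add int_e int_e')
  also have "\<dots> = ennreal (1 / 2) * ennreal 2"
    by simp
  also have "\<dots> = ennreal (1 / 2 * 2)"
    by (rule ennreal_mult[symmetric]) auto
  also have "\<dots> = 1"
    by simp
  finally show ?thesis
    by (intro prob_spaceI) (simp add: laplace_def emeasure_density)
qed

text \<open>This is the triangle inequality
  \<open>\<bar>x\<bar> \<le> \<bar>x - d\<bar> + \<bar>d\<bar>\<close> in the exponent.\<close>

lemma laplace_density_shift_le:
  assumes "0 < b"
  shows "laplace_density b (x - d) \<le> exp (\<bar>d\<bar> / b) * laplace_density b x"
proof -
  have "- \<bar>x - d\<bar> / b \<le> \<bar>d\<bar> / b + - \<bar>x\<bar> / b"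
    using assms by (simp add: field_simps)
  then have "exp (- \<bar>x - d\<bar> / b) \<le> exp (\<bar>d\<bar> / b) * exp (- \<bar>x\<bar> / b)"
    by (simp flip: exp_add)
  then show ?thesis
    using assms by (simp add: laplace_density_def field_simps)
qed

text \<open>Translation invariance of Lebesgue measure moves the shift from the integrand to the
  density, where the pointwise bound applies.\<close>

lemma nn_integral_laplace_shift_le:
  assumes "0 < b" and f [measurable]: "f \<in> borel_measurable borel"
  shows "(\<integral>\<^sup>+x. f (x + d) \<partial>laplace b) \<le> ennreal (exp (\<bar>d\<bar> / b)) * (\<integral>\<^sup>+x. f x \<partial>laplace b)"
proof -
  have "(\<integral>\<^sup>+x. f (x + d) \<partial>laplace b) = (\<integral>\<^sup>+x. ennreal (laplace_density b x) * f (x + d) \<partial>lborel)"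
    by (simp add: laplace_def nn_integral_density)
  also have "\<dots> = (\<integral>\<^sup>+x. ennreal (laplace_density b (x - d)) * f x \<partial>lborel)"
    using nn_integral_real_affine[of "\<lambda>x. ennreal (laplace_density b (x - d)) * f x" 1 d]
    by (simp add: add.commute)
  also have "\<dots> \<le> (\<integral>\<^sup>+x. ennreal (exp (\<bar>d\<bar> / b)) * (ennreal (laplace_density b x) * f x) \<partial>lborel)"
    using laplace_density_shift_le[OF assms(1)] assms(1)
    by (intro nn_integral_mono)
       (auto simp: mult.assoc[symmetric] ennreal_mult[symmetric] laplace_density_nonneg
             intro!: mult_right_mono ennreal_leI)
  also have "\<dots> = ennreal (exp (\<bar>d\<bar> / b)) * (\<integral>\<^sup>+x. f x \<partial>laplace b)"
    by (simp add: laplace_def nn_integral_density nn_integral_cmult)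
  finally show ?thesis .
qed

text \<open>Restricting to \<open>I\<close> keeps the shifted vector extensional, hence in the space
  of the product measure.\<close>

definition noise_shift :: "'i set \<Rightarrow> ('i \<Rightarrow> real) \<Rightarrow> ('i \<Rightarrow> real) \<Rightarrow> 'i \<Rightarrow> real" where
  "noise_shift I d w = (\<lambda>i\<in>I. w i + d i)"

lemma shift_apply [simp]: "i \<in> I \<Longrightarrow> noise_shift I d w i = w i + d i"
  by (simp add: noise_shift_def)

lemma measurable_shift [measurable]:
  "noise_shift I d \<in> Pi\<^sub>M I (\<lambda>_. laplace b) \<rightarrow>\<^sub>M Pi\<^sub>M I (\<lambda>_. laplace b)"
  unfolding noise_shift_def[abs_def] by measurable

text \<open>Coordinates are split off one at a time and the exponents of the one-dimensional bounds
  add up. Integrands rather than events are needed: the inner integral over the new coordinate is a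
  general nonnegative function of the others, and the induction hypothesis is applied to it.\<close>

lemma nn_integral_PiM_laplace_shift_le:
  assumes "finite I" "0 < b" and "f \<in> borel_measurable (Pi\<^sub>M I (\<lambda>_. laplace b))"
  shows "(\<integral>\<^sup>+w. f (noise_shift I d w) \<partial>Pi\<^sub>M I (\<lambda>_. laplace b))
    \<le> ennreal (exp ((\<Sum>i\<in>I. \<bar>d i\<bar>) / b)) * (\<integral>\<^sup>+w. f w \<partial>Pi\<^sub>M I (\<lambda>_. laplace b))"
  using assms(1,3)
proof (induction I arbitrary: f rule: finite_induct)
  case empty
  then show ?case
    by (simp add: PiM_empty nn_integral_count_space_finite noise_shift_def)
next
  case (insert i I)
  note [measurable] = insert.prems
  interpret prob_space "laplace b"
    by (rule prob_space_laplace) fact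
  interpret product_sigma_finite "\<lambda>_. laplace b"
    by standard
  have upd [measurable]: "(\<lambda>(w, x). w(i := x)) \<in>
      Pi\<^sub>M I (\<lambda>_. laplace b) \<Otimes>\<^sub>M laplace b \<rightarrow>\<^sub>M Pi\<^sub>M (insert i I) (\<lambda>_. laplace b)"
    by (rule measurable_add_dim)
  have shift_upd: "noise_shift (insert i I) d (w(i := x)) = (noise_shift I d w)(i := x + d i)" for w x
    using insert.hyps by (auto simp: noise_shift_def fun_eq_iff)
  have meas_x: "(\<lambda>x. f (w(i := x))) \<in> borel_measurable borel"
    if "w \<in> space (Pi\<^sub>M I (\<lambda>_. laplace b))" for w
  proof -
    have "(\<lambda>x. f (w(i := x))) \<in> borel_measurable (laplace b)"
      using measurable_compose[OF measurable_Pair1'[OF that] measurable_compose[OF upd insert.prems]]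
      by (simp only: prod.case)
    then show ?thesis
      using measurable_cong_sets[OF sets_laplace refl] by blast
  qed
  have "(\<integral>\<^sup>+w. f (noise_shift (insert i I) d w) \<partial>Pi\<^sub>M (insert i I) (\<lambda>_. laplace b))
     = (\<integral>\<^sup>+w. \<integral>\<^sup>+x. f ((noise_shift I d w)(i := x + d i)) \<partial>laplace b \<partial>Pi\<^sub>M I (\<lambda>_. laplace b))"
    using insert.hyps by (subst product_nn_integral_insert) (auto simp: shift_upd)
  also have "\<dots> \<le> (\<integral>\<^sup>+w. ennreal (exp (\<bar>d i\<bar> / b)) * (\<integral>\<^sup>+x. f ((noise_shift I d w)(i := x)) \<partial>laplace b)
      \<partial>Pi\<^sub>M I (\<lambda>_. laplace b))"
    using measurable_space[OF measurable_shift] assms(2)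
    by (intro nn_integral_mono nn_integral_laplace_shift_le meas_x) auto
  also have "\<dots> \<le> ennreal (exp ((\<Sum>j\<in>I. \<bar>d j\<bar>) / b)) *
      (\<integral>\<^sup>+w. ennreal (exp (\<bar>d i\<bar> / b)) * (\<integral>\<^sup>+x. f (w(i := x)) \<partial>laplace b) \<partial>Pi\<^sub>M I (\<lambda>_. laplace b))"
    by (rule insert.IH) measurable
  also have "\<dots> = ennreal (exp ((\<Sum>j\<in>insert i I. \<bar>d j\<bar>) / b)) *
      (\<integral>\<^sup>+w. f w \<partial>Pi\<^sub>M (insert i I) (\<lambda>_. laplace b))"
    using insert.hyps
    by (subst product_nn_integral_insert)
       (auto simp: nn_integral_cmult exp_add add_divide_distrib ennreal_mult mult_ac)
  finally show ?case .
qed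

lemma emeasure_PiM_laplace_shift_le:
  assumes "finite I" "0 < b" and [measurable]: "A \<in> sets (Pi\<^sub>M I (\<lambda>_. laplace b))"
  shows "emeasure (Pi\<^sub>M I (\<lambda>_. laplace b)) (noise_shift I d -` A \<inter> space (Pi\<^sub>M I (\<lambda>_. laplace b)))
    \<le> ennreal (exp ((\<Sum>i\<in>I. \<bar>d i\<bar>) / b)) * emeasure (Pi\<^sub>M I (\<lambda>_. laplace b)) A"
proof -
  let ?P = "Pi\<^sub>M I (\<lambda>_. laplace b)"
  have "emeasure ?P (noise_shift I d -` A \<inter> space ?P)
      = (\<integral>\<^sup>+w. indicator (noise_shift I d -` A \<inter> space ?P) w \<partial>?P)"
    by (rule nn_integral_indicator[symmetric]) measurable
  also have "\<dots> = (\<integral>\<^sup>+w. indicator A (noise_shift I d w) \<partial>?P)"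
    by (intro nn_integral_cong) (simp add: indicator_def)
  also have "\<dots> \<le> ennreal (exp ((\<Sum>i\<in>I. \<bar>d i\<bar>) / b)) * (\<integral>\<^sup>+w. indicator A w \<partial>?P)"
    using assms by (intro nn_integral_PiM_laplace_shift_le) auto
  finally show ?thesis by simp
qed

lemma prob_space_PiM_laplace: "0 < b \<Longrightarrow> prob_space (Pi\<^sub>M I (\<lambda>_. laplace b))"
  by (intro prob_space_PiM prob_space_laplace)

text \<open>
  A coupling of two outputs by a noise shift that may depend on a finitely-valued part
  \<open>tag\<close> of the published output: on each slice of the output space the shift is constant.
\<close>

lemma measure_distr_le_if_shift_coupling:
  fixes g g' :: "('i \<Rightarrow> real) \<Rightarrow> 'o" and tag :: "'o \<Rightarrow> 'c"
  defines "P \<equiv> \<lambda>I b. Pi\<^sub>M I (\<lambda>_. laplace b)"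
  assumes I: "finite I" and b: "0 < b"
    and g [measurable]: "g \<in> P I b \<rightarrow>\<^sub>M Out" and g' [measurable]: "g' \<in> P I b \<rightarrow>\<^sub>M Out"
    and T: "finite T" "\<And>w. w \<in> space (P I b) \<Longrightarrow> tag (g w) \<in> T"
    and tag: "\<And>t. t \<in> T \<Longrightarrow> {z \<in> space Out. tag z = t} \<in> sets Out"
    and couple: "\<And>t w. \<lbrakk>t \<in> T; w \<in> space (P I b); tag (g w) = t\<rbrakk> \<Longrightarrow> g' (noise_shift I (d t) w) = g w"
    and cost: "\<And>t. t \<in> T \<Longrightarrow> (\<Sum>i\<in>I. \<bar>d t i\<bar>) / b \<le> \<epsilon>"
    and S: "S \<in> sets Out"
  shows "measure (distr (P I b) Out g) S \<le> exp \<epsilon> * measure (distr (P I b) Out g') S"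
proof -
  interpret prob_space "P I b"
    unfolding P_def using b by (rule prob_space_PiM_laplace)
  define St where "St t = S \<inter> {z \<in> space Out. tag z = t}" for t
  have St: "St t \<in> sets Out" if "t \<in> T" for t
    using S tag[OF that] by (auto simp: St_def)
  have disj: "disjoint_family_on (\<lambda>t. h -` St t \<inter> space (P I b)) T" for h :: "('i \<Rightarrow> real) \<Rightarrow> 'o"
    by (auto simp: disjoint_family_on_def St_def)
  have slice: "emeasure (P I b) (g -` St t \<inter> space (P I b))
      \<le> ennreal (exp \<epsilon>) * emeasure (P I b) (g' -` St t \<inter> space (P I b))" if t: "t \<in> T" for t
  proof -
    note St[OF t, measurable]
    have shift_space: "noise_shift I (d t) w \<in> space (P I b)" if "w \<in> space (P I b)" for w
      using that measurable_space[OF measurable_shift] unfolding P_def by blast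
    have meas: "g' -` St t \<inter> space (P I b) \<in> sets (P I b)"
      by measurable
    have "emeasure (P I b) (g -` St t \<inter> space (P I b))
        \<le> emeasure (P I b) (noise_shift I (d t) -` (g' -` St t \<inter> space (P I b)) \<inter> space (P I b))"
    proof (rule emeasure_mono)
      \<comment> \<open>On this slice \<open>g'\<close> after the shift equals \<open>g\<close>, so
        the shift maps the event for \<open>g\<close> into the event for \<open>g'\<close>.\<close>
      show "g -` St t \<inter> space (P I b) \<subseteq>
          noise_shift I (d t) -` (g' -` St t \<inter> space (P I b)) \<inter> space (P I b)"
        using couple[OF t] shift_space by (auto simp: St_def)
      show "noise_shift I (d t) -` (g' -` St t \<inter> space (P I b)) \<inter> space (P I b) \<in> sets (P I b)"
        using meas unfolding P_def by (intro measurable_sets[OF measurable_shift])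
    qed
    also have "\<dots> \<le> ennreal (exp ((\<Sum>i\<in>I. \<bar>d t i\<bar>) / b)) *
        emeasure (P I b) (g' -` St t \<inter> space (P I b))"
      using meas unfolding P_def by (intro emeasure_PiM_laplace_shift_le I b)
    also have "\<dots> \<le> ennreal (exp \<epsilon>) * emeasure (P I b) (g' -` St t \<inter> space (P I b))"
      using cost[OF t] by (intro mult_right_mono ennreal_leI) auto
    finally show ?thesis .
  qed
  have "emeasure (distr (P I b) Out g) S = emeasure (P I b) (g -` S \<inter> space (P I b))"
    using S by (simp add: emeasure_distr)
  also have "g -` S \<inter> space (P I b) = (\<Union>t\<in>T. g -` St t \<inter> space (P I b))"
    using T(2) measurable_space[OF g] by (auto simp: St_def)
  also have "emeasure (P I b) \<dots> = (\<Sum>t\<in>T. emeasure (P I b) (g -` St t \<inter> space (P I b)))"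
    using St T(1) disj by (intro sum_emeasure[symmetric]) (auto intro: measurable_sets[OF g])
  also have "\<dots> \<le> (\<Sum>t\<in>T. ennreal (exp \<epsilon>) * emeasure (P I b) (g' -` St t \<inter> space (P I b)))"
    by (intro sum_mono slice)
  also have "\<dots> = ennreal (exp \<epsilon>) * emeasure (P I b) (\<Union>t\<in>T. g' -` St t \<inter> space (P I b))"
    using St T(1) disj
    by (simp only: sum_distrib_left[symmetric], subst sum_emeasure)
       (auto intro: measurable_sets[OF g'])
  also have "\<dots> \<le> ennreal (exp \<epsilon>) * emeasure (P I b) (g' -` S \<inter> space (P I b))"
    using S by (intro mult_left_mono emeasure_mono) (auto simp: St_def)
  also have "\<dots> = ennreal (exp \<epsilon>) * emeasure (distr (P I b) Out g') S"
    using S by (simp add: emeasure_distr)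
  finally have le: "emeasure (distr (P I b) Out g) S \<le> ennreal (exp \<epsilon>) * emeasure (distr (P I b) Out g') S" .
  interpret D: prob_space "distr (P I b) Out g" by (rule prob_space_distr) fact
  interpret D': prob_space "distr (P I b) Out g'" by (rule prob_space_distr) fact
  show ?thesis
    using le by (simp add: D.emeasure_eq_measure D'.emeasure_eq_measure ennreal_mult[symmetric])
qed

section \<open>Shifting the tree noise\<close>

text \<open>
  A suffix starting at \<open>a\<close> differs from one starting at the even neighbour \<open>2c\<close> in a single leaf,
  and the latter is a suffix one level up. For odd \<open>a\<close> we choose the neighbour with \<open>c\<close> even
  (the non-adjacent form of \<open>a\<close>), so that only every second level costs a leaf.
\<close>

lemma suffix_dyadic_decomposition:
  assumes "a \<le> 2 ^ L"
  shows "\<exists>\<delta> :: nat \<Rightarrow> nat \<Rightarrow> real.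
    (\<forall>i<2 ^ L. (\<Sum>l\<le>L. \<delta> l (i div 2 ^ l)) = of_bool (a \<le> i)) \<and>
    (\<Sum>l\<le>L. \<Sum>j<2 ^ (L - l). \<bar>\<delta> l j\<bar>) \<le> (if even a then real L + 2 else real L + 3) / 2"
  using assms
proof (induction L arbitrary: a)
  case 0
  then show ?case
    by (intro exI[of _ "\<lambda>_ _. of_bool (a = 0)"]) (auto simp: le_Suc_eq)
next
  case (Suc L)
  \<comment> \<open>One level of the recursion: \<open>c\<close> is the suffix start on the next
    level, \<open>x\<close> the corrected leaf, \<open>s\<close> its sign (or \<open>0\<close>) and
    \<open>r\<close> its cost. The budget grows by \<open>1 / 2\<close> per level and is
    \<open>1 / 2\<close> smaller for even starts; a leaf of cost \<open>1\<close> is affordable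
    exactly when \<open>a\<close> is odd and \<open>c\<close> even.\<close>
  have step: ?case
    if c: "c \<le> 2 ^ L" and x: "\<bar>s\<bar> = r"
      and eq: "\<And>i. of_bool (a \<le> i) = of_bool (c \<le> i div 2) + s * of_bool (i = x)"
      and cost: "(if even c then real L + 2 else real L + 3) / 2 + r
          \<le> (if even a then real (Suc L) + 2 else real (Suc L) + 3) / 2"
    for c x :: nat and s r :: real
  proof -
    obtain \<delta> :: "nat \<Rightarrow> nat \<Rightarrow> real" where
      \<delta>: "\<And>i. i < 2 ^ L \<Longrightarrow> (\<Sum>l\<le>L. \<delta> l (i div 2 ^ l)) = of_bool (c \<le> i)"
         "(\<Sum>l\<le>L. \<Sum>j<2 ^ (L - l). \<bar>\<delta> l j\<bar>) \<le> (if even c then real L + 2 else real L + 3) / 2"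
      using Suc.IH[OF c] by blast
    \<comment> \<open>The leaf correction sits on level \<open>0\<close>; node \<open>j\<close> on
      level \<open>l\<close> of the tree over pairs is node \<open>j\<close> on level
      \<open>Suc l\<close> of the whole tree.\<close>
    define \<delta>' where "\<delta>' l j = (case l of 0 \<Rightarrow> s * of_bool (j = x) | Suc l \<Rightarrow> \<delta> l j)" for l j
    have "(\<Sum>l\<le>Suc L. \<delta>' l (i div 2 ^ l)) = of_bool (a \<le> i)" if "i < 2 ^ Suc L" for i
    proof -
      have "(\<Sum>l\<le>Suc L. \<delta>' l (i div 2 ^ l)) = s * of_bool (i = x) + (\<Sum>l\<le>L. \<delta> l ((i div 2) div 2 ^ l))"
        by (simp add: sum.atMost_Suc_shift \<delta>'_def div_mult2_eq del: sum.atMost_Suc)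
      also have "(\<Sum>l\<le>L. \<delta> l ((i div 2) div 2 ^ l)) = of_bool (c \<le> i div 2)"
        using that by (intro \<delta>(1)) auto
      finally show ?thesis by (simp only: eq[of i])
    qed
    moreover have "(\<Sum>l\<le>Suc L. \<Sum>j<2 ^ (Suc L - l). \<bar>\<delta>' l j\<bar>)
        \<le> (if even a then real (Suc L) + 2 else real (Suc L) + 3) / 2"
    proof -
      have "(\<Sum>j<2 ^ Suc L. \<bar>s * of_bool (j = x)\<bar>) = (\<Sum>j<2 ^ Suc L. if j = x then \<bar>s\<bar> else 0)"
        by (intro sum.cong) auto
      also have "\<dots> \<le> r"
        using x by (subst sum.delta) auto
      finally have "(\<Sum>j<2 ^ Suc L. \<bar>s * of_bool (j = x)\<bar>) \<le> r" .
      then show ?thesis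
        using \<delta>(2) cost by (simp add: sum.atMost_Suc_shift \<delta>'_def del: power_Suc sum.atMost_Suc)
    qed
    ultimately show ?thesis by blast
  qed
  consider c where "a = 2 * c" | c where "a = 2 * c + 1" "even c" | c where "a = 2 * c + 1" "odd c"
    by (meson evenE oddE)
  then show ?case
  proof cases
    case (1 c)
    then show ?thesis
      using Suc.prems by (intro step[of c 0 0 0]) auto
  next
    \<comment> \<open>Round down to \<open>2 * c\<close>, with \<open>c\<close> even, and subtract
      the extra leaf \<open>2 * c\<close>.\<close>
    case (2 c)
    then show ?thesis
      using Suc.prems by (intro step[of c "-1" 1 "2 * c"]) (auto simp: of_bool_def)
  next
    \<comment> \<open>Round up to \<open>2 * (c + 1)\<close>, with \<open>c + 1\<close> even, and
      add the missing leaf \<open>2 * c + 1\<close>.\<close>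
    case (3 c)
    then show ?thesis
      using Suc.prems by (intro step[of "c + 1" 1 1 "2 * c + 1"]) (auto simp: of_bool_def)
  qed
qed

text \<open>Translates the node labels of the algorithm, counted from 1, into the ancestors of leaf
  \<open>i - 1\<close> counted from 0 in the dyadic decomposition.\<close>

lemma nat_ceiling_divide_power:
  assumes "1 \<le> i"
  shows "nat \<lceil>real i / 2 ^ l\<rceil> = (i - 1) div 2 ^ l + 1"
proof -
  define q r where "q = (i - 1) div 2 ^ l" and "r = (i - 1) mod 2 ^ l"
  have "i = q * 2 ^ l + r + 1" and "r < 2 ^ l"
    using assms div_mult_mod_eq[of "i - 1" "2 ^ l"] unfolding q_def r_def by linarith simp
  have i: "real i = real q * 2 ^ l + real r + 1"
    by (subst \<open>i = q * 2 ^ l + r + 1\<close>) simp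
  have "real (r + 1) \<le> real (2 ^ l)"
    using \<open>r < 2 ^ l\<close> by (intro of_nat_mono) simp
  then have r: "real r + 1 \<le> 2 ^ l" by simp
  have "\<lceil>real i / 2 ^ l\<rceil> = int q + 1"
    using r unfolding i by (intro ceiling_unique) (auto simp: field_simps)
  then show ?thesis by (simp add: q_def)
qed

text \<open>On an increasing grid, an instance with score \<open>y\<close> is counted from some grid
  point onwards. The start \<open>a\<close> is counted from 0, and \<open>a = N\<close> encodes the
  empty suffix when no grid point reaches \<open>y\<close>.\<close>

lemma threshold_indicator_eq_suffix:
  fixes \<tau> :: "nat \<Rightarrow> real"
  assumes "strict_mono_on {1..N} \<tau>"
  obtains a where "a \<le> N" "\<And>i. i \<in> {1..N} \<Longrightarrow> (y \<le> \<tau> i \<longleftrightarrow> a \<le> i - 1)"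
proof (cases "\<exists>i\<in>{1..N}. y \<le> \<tau> i")
  case True
  define m where "m = (LEAST i. i \<in> {1..N} \<and> y \<le> \<tau> i)"
  have m: "m \<in> {1..N}" "y \<le> \<tau> m"
    using LeastI_ex[of "\<lambda>i. i \<in> {1..N} \<and> y \<le> \<tau> i"] True unfolding m_def by blast+
  have "y \<le> \<tau> i \<longleftrightarrow> m - 1 \<le> i - 1" if i: "i \<in> {1..N}" for i
  proof
    assume "y \<le> \<tau> i"
    then have "m \<le> i" unfolding m_def using i by (intro Least_le) auto
    then show "m - 1 \<le> i - 1" by simp
  next
    assume "m - 1 \<le> i - 1"
    then have "m \<le> i" using m(1) i by auto
    then have "\<tau> m \<le> \<tau> i"
      using assms m(1) i by (simp add: strict_mono_on_leD)
    then show "y \<le> \<tau> i" using m(2) by simp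
  qed
  then show ?thesis using that[of "m - 1"] m(1) by auto
next
  case False
  show ?thesis
  proof (rule that[of N])
    show "y \<le> \<tau> i \<longleftrightarrow> N \<le> i - 1" if "i \<in> {1..N}" for i
      using False that by (auto simp del: One_nat_def)
  qed simp
qed

section \<open>Bisection\<close>

text \<open>After \<open>j\<close> steps the bisection interval is \<open>[k / 2 ^ j, (k + 1) / 2 ^ j]\<close> for this \<open>k\<close>.\<close>

primrec bisect_index :: "(real \<Rightarrow> real) \<Rightarrow> real \<Rightarrow> nat \<Rightarrow> nat" where
  "bisect_index F p 0 = 0"
| "bisect_index F p (Suc j) =
     2 * bisect_index F p j +
     (if F (real (2 * bisect_index F p j + 1) / 2 ^ Suc j) < p then 1 else 0)"

lemma bisect_index_less: "bisect_index F p j < 2 ^ j"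
  by (induction j) auto

text \<open>This holds for arbitrary \<open>F\<close>, which matters because noise can destroy the
  monotonicity of an ECDF. While the indices agree, both searches query the same midpoint; once they
  differ by at least 1, doubling makes the gap at least 2, which one step cannot close.\<close>

lemma bisect_index_mono: "p \<le> p' \<Longrightarrow> bisect_index F p j \<le> bisect_index F p' j"
proof (induction j)
  case (Suc j)
  then consider "bisect_index F p j = bisect_index F p' j"
    | "Suc (bisect_index F p j) \<le> bisect_index F p' j" by fastforce
  then show ?case using Suc.prems by cases auto
qed simp

text \<open>A query on an earlier level is an odd multiple of a coarser power of 1/2, hence also an
  interior point of the finest grid.\<close>

lemma bisect_index_cong:
  assumes "\<And>k. 0 < k \<Longrightarrow> k < 2 ^ K \<Longrightarrow> F (real k / 2 ^ K) = G (real k / 2 ^ K)" and "j \<le> K"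
  shows "bisect_index F p j = bisect_index G p j"
  using assms(2)
proof (induction j)
  case (Suc j)
  let ?k = "2 * bisect_index G p j + 1"
  have k: "?k < 2 ^ Suc j"
    using bisect_index_less[of G p j] by simp
  have "?k * 2 ^ (K - Suc j) < 2 ^ Suc j * 2 ^ (K - Suc j)"
    using k by (intro mult_strict_right_mono) auto
  also have "\<dots> = 2 ^ K"
    using Suc.prems by (metis le_add_diff_inverse power_add)
  finally have less: "?k * 2 ^ (K - Suc j) < 2 ^ K" .
  have "real (?k * 2 ^ (K - Suc j)) / 2 ^ K = real ?k / 2 ^ Suc j"
  proof -
    have "(2 :: real) ^ K = 2 ^ (K - Suc j) * 2 ^ Suc j"
      using Suc.prems by (metis le_add_diff_inverse2 power_add)
    then have "real (?k * 2 ^ (K - Suc j)) / 2 ^ K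
        = (2 ^ (K - Suc j) * real ?k) / (2 ^ (K - Suc j) * 2 ^ Suc j)"
      by (simp only: of_nat_mult of_nat_power of_nat_numeral mult.commute)
    then show ?thesis by (simp only: mult_divide_mult_cancel_left_if) simp
  qed
  then have "F (real ?k / 2 ^ Suc j) = G (real ?k / 2 ^ Suc j)"
    using assms(1)[of "?k * 2 ^ (K - Suc j)"] less by (simp del: power_Suc)
  then show ?case using Suc by simp
qed simp

text \<open>The interval has length \<open>1 / 2 ^ j\<close> after \<open>j\<close> steps, so by
  minimality of \<open>K\<close> the loop makes exactly \<open>K\<close> steps. The closed form then
  yields measurability, monotonicity and finiteness of the thresholds.\<close>

lemma bisection_eq_bisect_index:
  assumes "0 < \<psi>" and K: "K = (LEAST K. 1 / 2 ^ K \<le> \<psi>)"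
  shows "bisection \<psi> F p = (2 * real (bisect_index F p K) + 1) / 2 ^ Suc K"
proof -
  let ?c = "\<lambda>(a, b). b - a > \<psi>"
  let ?s = "\<lambda>(a, b). let m = (a + b) / 2 in if F m < p then (m, b) else (a, m)"
  let ?k = "bisect_index F p"
  let ?I = "\<lambda>j. (real (?k j) / 2 ^ j, (real (?k j) + 1) / 2 ^ j)"
  have "\<exists>K. 1 / 2 ^ K \<le> \<psi>"
    using real_arch_pow_inv[OF assms(1), of "1 / 2"] by (auto simp: power_one_over intro: less_imp_le)
  then have "1 / 2 ^ K \<le> \<psi>"
    unfolding K by (rule LeastI_ex)
  then have stop: "\<not> ?c (?I K)"
    by (simp add: field_simps)
  have go: "?c (?I j)" if "j < K" for j
    using not_less_Least[OF that[unfolded K]] by (simp add: diff_divide_distrib[symmetric])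
  have step: "?s (?I j) = ?I (Suc j)" for j
  proof -
    have mid: "(real (?k j) / 2 ^ j + (real (?k j) + 1) / 2 ^ j) / 2 = real (2 * ?k j + 1) / 2 ^ Suc j"
      by (simp add: field_simps)
    show ?thesis
      by (simp only: prod.case Let_def mid) (auto simp: field_simps)
  qed
  have "j \<le> K \<Longrightarrow> while ?c ?s (0, 1) = while ?c ?s (?I j)" for j
  proof (induction j)
    case (Suc j)
    then have "while ?c ?s (0, 1) = while ?c ?s (?I j)" by simp
    also have "\<dots> = while ?c ?s (?s (?I j))"
      using go[of j] Suc.prems by (subst while_unfold) simp
    finally show ?case by (simp only: step)
  qed simp
  then have "while ?c ?s (0, 1) = while ?c ?s (?I K)"
    by blast
  also have "\<dots> = ?I K"
    using stop by (subst while_unfold) (simp only: if_False)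
  finally have "while ?c ?s (0, 1) = ?I K" .
  then show ?thesis
    by (simp add: bisection_def field_simps)
qed

section \<open>The noise labels\<close>

lemma noise_labels_eq:
  "noise_labels L Q =
     (\<lambda>(l, j). Eta (Suc j) l) ` (SIGMA l:{..L}. {..<2 ^ (L - l)}) \<union>
     (\<lambda>(q, s). Xi s q) ` ({1..Q} \<times> {0, 1}) \<union>
     (\<lambda>(q, s). Zeta s q) ` ({1..Q} \<times> {0, 1})"
proof -
  have "{Eta j l | j l. l \<le> L \<and> 1 \<le> j \<and> j \<le> 2 ^ (L - l)} =
      (\<lambda>(l, j). Eta (Suc j) l) ` (SIGMA l:{..L}. {..<2 ^ (L - l)})"
  proof (intro set_eqI iffI)
    fix x assume "x \<in> {Eta j l | j l. l \<le> L \<and> 1 \<le> j \<and> j \<le> 2 ^ (L - l)}"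
    then obtain j l where "x = Eta j l" "l \<le> L" "1 \<le> j" "j \<le> 2 ^ (L - l)"
      by blast
    then have "x = Eta (Suc (j - 1)) l" "l \<le> L" "j - 1 < 2 ^ (L - l)"
      by auto
    then show "x \<in> (\<lambda>(l, j). Eta (Suc j) l) ` (SIGMA l:{..L}. {..<2 ^ (L - l)})"
      by (intro image_eqI[of _ _ "(l, j - 1)"]) auto
  qed auto
  moreover have "{Xi s q | s q. s \<in> {0, 1} \<and> q \<in> {1..Q}} = (\<lambda>(q, s). Xi s q) ` ({1..Q} \<times> {0, 1})"
    "{Zeta s q | s q. s \<in> {0, 1} \<and> q \<in> {1..Q}} = (\<lambda>(q, s). Zeta s q) ` ({1..Q} \<times> {0, 1})"
    by auto
  ultimately show ?thesis unfolding noise_labels_def by simp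
qed

lemma finite_noise_labels: "finite (noise_labels L Q)"
  unfolding noise_labels_eq by blast

lemma sum_noise_labels:
  fixes f :: "noise_label \<Rightarrow> 'a :: comm_monoid_add"
  shows "(\<Sum>i\<in>noise_labels L Q. f i) =
     (\<Sum>l\<le>L. \<Sum>j<2 ^ (L - l). f (Eta (Suc j) l)) +
     (\<Sum>q=1..Q. \<Sum>s\<in>{0, 1}. f (Xi s q)) + (\<Sum>q=1..Q. \<Sum>s\<in>{0, 1}. f (Zeta s q))"
proof -
  let ?eta = "\<lambda>(l, j). Eta (Suc j) l" and ?xi = "\<lambda>(q, s). Xi s q" and ?zeta = "\<lambda>(q, s). Zeta s q"
  let ?A = "SIGMA l:{..L}. {..<2 ^ (L - l)}" and ?B = "{1..Q} \<times> {0, 1 :: nat}"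
  have inj: "inj_on ?eta ?A" "inj_on ?xi ?B" "inj_on ?zeta ?B"
    by (auto simp: inj_on_def)
  have "sum f (?eta ` ?A) = (\<Sum>l\<le>L. \<Sum>j<2 ^ (L - l). f (Eta (Suc j) l))"
    unfolding sum.reindex[OF inj(1)] by (subst sum.Sigma) (auto intro: sum.cong)
  moreover have "sum f (?xi ` ?B) = (\<Sum>q=1..Q. \<Sum>s\<in>{0, 1}. f (Xi s q))"
    unfolding sum.reindex[OF inj(2)] sum.cartesian_product by (rule sum.cong) auto
  moreover have "sum f (?zeta ` ?B) = (\<Sum>q=1..Q. \<Sum>s\<in>{0, 1}. f (Zeta s q))"
    unfolding sum.reindex[OF inj(3)] sum.cartesian_product by (rule sum.cong) auto
  moreover have "sum f (noise_labels L Q) = sum f (?eta ` ?A) + sum f (?xi ` ?B) + sum f (?zeta ` ?B)"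
  proof -
    have fin: "finite (?eta ` ?A)" "finite (?xi ` ?B)" "finite (?zeta ` ?B)"
      by blast+
    have disj: "?eta ` ?A \<inter> ?xi ` ?B = {}" "(?eta ` ?A \<union> ?xi ` ?B) \<inter> ?zeta ` ?B = {}"
      by auto
    show ?thesis
      unfolding noise_labels_eq
      by (simp only: sum.union_disjoint[OF finite_UnI[OF fin(1,2)] fin(3) disj(2)]
          sum.union_disjoint[OF fin(1,2) disj(1)])
  qed
  ultimately show ?thesis by (simp only:)
qed

text \<open>Labels outside the index set are covered too: there every point of the product space has
  the constant value \<open>undefined\<close>. Later measurability proofs thus avoid index
  bounds.\<close>

lemma measurable_noise: "(\<lambda>w. w i) \<in> borel_measurable (noise_measure L Q b)"
proof (cases "i \<in> noise_labels L Q")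
  case True
  then have "(\<lambda>w. w i) \<in> noise_measure L Q b \<rightarrow>\<^sub>M laplace b"
    unfolding noise_measure_def by measurable
  then show ?thesis
    using measurable_cong_sets[OF refl sets_laplace] by blast
next
  case False
  then have "w i = undefined" if "w \<in> space (noise_measure L Q b)" for w
    using that unfolding noise_measure_def space_PiM by (auto intro: PiE_arb)
  then show ?thesis
    using measurable_cong[of "noise_measure L Q b" "\<lambda>w. w i" "\<lambda>_. undefined" borel] by simp
qed

lemmas measurable_noise_label [measurable] =
  measurable_noise[of "Eta j l" for j l] measurable_noise[of "Xi s q" for s q]
  measurable_noise[of "Zeta s q" for s q]

section \<open>Measurability of the published output\<close>

text \<open>Membership as a property of the instance alone turns sums over a random group into sums
  over the fixed set of positions.\<close>

definition in_group :: "('x \<Rightarrow> real) \<Rightarrow> (nat \<Rightarrow> real) \<Rightarrow> nat \<Rightarrow> 'x \<Rightarrow> bool" where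
  "in_group M t q x \<longleftrightarrow> (if q = 1 then t 0 \<le> M x else t (q - 1) < M x) \<and> M x \<le> t q"

lemma sum_group:
  "(\<Sum>k\<in>group M t X q. f (X ! k)) =
     (\<Sum>k<length X. if in_group M t q (X ! k) then f (X ! k) else 0)"
proof -
  have "group M t X q = {k \<in> {..<length X}. in_group M t q (X ! k)}"
    by (auto simp: group_def in_group_def)
  then show ?thesis by (simp only: sum.inter_filter finite_lessThan)
qed

lemma measurable_noisy_ecdf [measurable]:
  "(\<lambda>w. noisy_ecdf M \<tau> L X w i) \<in> borel_measurable (noise_measure L' Q b)"
  unfolding noisy_ecdf_def by measurable

lemma measurable_bisect_index:
  assumes [measurable]: "\<And>m. (\<lambda>w. F w m) \<in> borel_measurable P"
  shows "(\<lambda>w. bisect_index (F w) p j) \<in> P \<rightarrow>\<^sub>M count_space UNIV"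
proof (induction j)
  case (Suc j)
  \<comment> \<open>The query point depends on \<open>w\<close> through the previous index. Fixing
    that index as \<open>k\<close> makes the point deterministic, and countably many values of
    \<open>k\<close> are then glued together.\<close>
  have "(\<lambda>w. 2 * k + (if F w (real (2 * k + 1) / 2 ^ Suc j) < p then 1 else 0)) \<in> P \<rightarrow>\<^sub>M count_space UNIV"
    for k :: nat
    by measurable
  from measurable_compose_countable[OF this Suc] show ?case by simp
qed simp

lemma measurable_threshold:
  assumes "0 < \<psi>"
  shows "(\<lambda>w. threshold M \<tau> N L Q \<psi> X w q) \<in> borel_measurable (noise_measure L' Q' b)"
proof -
  have [measurable]: "(\<lambda>w. noisy_ecdf_at M \<tau> N L X w m) \<in> borel_measurable (noise_measure L' Q' b)" for m
    unfolding noisy_ecdf_at_def by measurable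
  define K where "K = (LEAST K. 1 / 2 ^ K \<le> \<psi>)"
  have "(\<lambda>w. bisect_index (noisy_ecdf_at M \<tau> N L X w) p K)
      \<in> noise_measure L' Q' b \<rightarrow>\<^sub>M count_space UNIV" for p
    by (rule measurable_bisect_index) measurable
  then have "(\<lambda>w. real (bisect_index (noisy_ecdf_at M \<tau> N L X w) p K))
      \<in> borel_measurable (noise_measure L' Q' b)" for p
    by (rule measurable_compose) simp
  then have "(\<lambda>w. bisection \<psi> (noisy_ecdf_at M \<tau> N L X w) p) \<in> borel_measurable (noise_measure L' Q' b)" for p
    unfolding bisection_eq_bisect_index[OF assms K_def]
    by (intro borel_measurable_divide borel_measurable_add borel_measurable_times borel_measurable_const)
  then show ?thesis
    by (cases "q = 0"; cases "q = Q") (simp_all add: threshold_def)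
qed

lemma measurable_predicted_count:
  assumes [measurable]: "\<And>q. (\<lambda>w. t w q) \<in> borel_measurable (noise_measure L Q b)"
  shows "(\<lambda>w. predicted_count M (t w) X w s q) \<in> borel_measurable (noise_measure L Q b)"
  unfolding predicted_count_def sum_group[where f = "\<lambda>x. if s = 1 then M x else 1 - M x"] in_group_def
  by measurable

lemma measurable_observed_count:
  assumes [measurable]: "\<And>q. (\<lambda>w. t w q) \<in> borel_measurable (noise_measure L Q b)"
  shows "(\<lambda>w. observed_count M Y (t w) X w s q) \<in> borel_measurable (noise_measure L Q b)"
  unfolding observed_count_def sum_group[where f = "\<lambda>x. if s = 1 then Y x else 1 - Y x"] in_group_def
  by measurable

lemma measurable_hl_output:
  assumes "0 < \<psi>"
  shows "hl_output M Y \<tau> N L Q \<psi> X \<in> noise_measure L' Q b \<rightarrow>\<^sub>M hl_output_space N Q"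
proof -
  let ?t = "threshold M \<tau> N L Q \<psi> X"
  let ?P = "noise_measure L' Q b"
  have t: "(\<lambda>w. ?t w q) \<in> borel_measurable ?P" for q
    by (rule measurable_threshold[OF assms])
  have E: "(\<lambda>w. predicted_count M (?t w) X w s q) \<in> borel_measurable ?P" for s q
    by (rule measurable_predicted_count[OF t])
  have Ob: "(\<lambda>w. observed_count M Y (?t w) X w s q) \<in> borel_measurable ?P" for s q
    by (rule measurable_observed_count[OF t])
  have H: "(\<lambda>w. hl_statistic Q (predicted_count M (?t w) X w) (observed_count M Y (?t w) X w))
      \<in> borel_measurable ?P"
    unfolding hl_statistic_def
    by (intro borel_measurable_sum borel_measurable_add borel_measurable_divide
        borel_measurable_power borel_measurable_diff E Ob)
  have E': "(\<lambda>w. \<lambda>(s, q)\<in>{0, 1} \<times> {1..Q}. predicted_count M (?t w) X w s q)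
      \<in> ?P \<rightarrow>\<^sub>M Pi\<^sub>M ({0, 1} \<times> {1..Q}) (\<lambda>_. borel)"
    unfolding case_prod_beta by (rule measurable_restrict) (rule E)
  have Ob': "(\<lambda>w. \<lambda>(s, q)\<in>{0, 1} \<times> {1..Q}. observed_count M Y (?t w) X w s q)
      \<in> ?P \<rightarrow>\<^sub>M Pi\<^sub>M ({0, 1} \<times> {1..Q}) (\<lambda>_. borel)"
    unfolding case_prod_beta by (rule measurable_restrict) (rule Ob)
  have F: "(\<lambda>w. \<lambda>i\<in>{1..N}. noisy_ecdf M \<tau> L X w i) \<in> ?P \<rightarrow>\<^sub>M Pi\<^sub>M {1..N} (\<lambda>_. borel)"
    by (rule measurable_restrict) (rule measurable_noisy_ecdf)
  have t': "(\<lambda>w. \<lambda>q\<in>{0..Q}. ?t w q) \<in> ?P \<rightarrow>\<^sub>M Pi\<^sub>M {0..Q} (\<lambda>_. borel)"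
    by (rule measurable_restrict) (rule t)
  show ?thesis
    unfolding hl_output_def[abs_def] hl_output_space_def Let_def
    by (rule measurable_Pair[OF F measurable_Pair[OF t' measurable_Pair[OF E' measurable_Pair[OF Ob' H]]]])
qed

section \<open>Sensitivity\<close>

lemma adjacent_sum:
  fixes f :: "'x \<Rightarrow> real"
  assumes "length X = length X'" "k0 < length X" "\<And>k. k < length X \<Longrightarrow> k \<noteq> k0 \<Longrightarrow> X ! k = X' ! k"
  shows "(\<Sum>k<length X. f (X ! k)) = (\<Sum>k<length X'. f (X' ! k)) + (f (X ! k0) - f (X' ! k0))"
proof -
  have "(\<Sum>k\<in>{..<length X} - {k0}. f (X ! k)) = (\<Sum>k\<in>{..<length X} - {k0}. f (X' ! k))"
    using assms by (intro sum.cong) auto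
  then show ?thesis
    using assms sum.remove[of "{..<length X}" k0 "\<lambda>k. f (X ! k)"]
      sum.remove[of "{..<length X'}" k0 "\<lambda>k. f (X' ! k)"] by simp
qed

text \<open>Monotone thresholds make the groups disjoint, so at most one summand is nonzero.\<close>

lemma sum_in_group_le:
  assumes "mono_on {0..Q} t" "0 \<le> (c :: real)"
  shows "(\<Sum>q=1..Q. if in_group M t q x then c else 0) \<le> c"
proof (cases "\<exists>q\<in>{1..Q}. in_group M t q x")
  case True
  then obtain q where q: "q \<in> {1..Q}" "in_group M t q x" by blast
  have disjoint: False
    if "r \<in> {1..Q}" "r' \<in> {1..Q}" "in_group M t r x" "in_group M t r' x" "r < r'" for r r'
  proof -
    \<comment> \<open>Here \<open>r' \<ge> 2\<close>, so group \<open>r'\<close> has a strict lower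
      bound: \<open>M x \<le> t r \<le> t (r' - 1) < M x\<close>.\<close>
    have "t r \<le> t (r' - 1)"
      using that by (intro mono_onD[OF assms(1)]) auto
    then show False using that by (auto simp: in_group_def)
  qed
  have "in_group M t r x \<longleftrightarrow> r = q" if r: "r \<in> {1..Q}" for r
    using disjoint[OF r q(1) _ q(2)] disjoint[OF q(1) r q(2)] q(2) linorder_neqE_nat by blast
  then have "(\<Sum>r=1..Q. if in_group M t r x then c else 0) = (\<Sum>r=1..Q. if r = q then c else 0)"
    by (intro sum.cong) simp_all
  then show ?thesis using q by simp
next
  case False
  then have "(\<Sum>q=1..Q. if in_group M t q x then c else 0) = 0"
    by (intro sum.neutral) auto
  then show ?thesis using assms(2) by simp
qed

text \<open>A changed instance leaves at most one group and enters at most one group.\<close>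

lemma group_count_shift_le:
  assumes "mono_on {0..Q} t" and "\<And>x. f x \<in> {0..1 :: real}"
  shows "(\<Sum>q=1..Q. \<Sum>s\<in>{0, 1 :: nat}.
      \<bar>(if in_group M t q x then if s = 1 then f x else 1 - f x else 0) -
       (if in_group M t q x' then if s = 1 then f x' else 1 - f x' else 0)\<bar>) \<le> 2"
proof -
  \<comment> \<open>If only one of the two instances is in the group, its contributions
    \<open>f x\<close> and \<open>1 - f x\<close> sum to 1 over \<open>s\<close>; if both are, the
    cost is twice \<open>\<bar>f x - f x'\<bar>\<close>, at most 2.\<close>
  have "(\<Sum>q=1..Q. \<Sum>s\<in>{0, 1 :: nat}.
      \<bar>(if in_group M t q x then if s = 1 then f x else 1 - f x else 0) -
       (if in_group M t q x' then if s = 1 then f x' else 1 - f x' else 0)\<bar>)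
    \<le> (\<Sum>q=1..Q. (if in_group M t q x then 1 else 0) + (if in_group M t q x' then 1 else 0))"
    using assms(2)[of x] assms(2)[of x'] by (intro sum_mono) auto
  also have "\<dots> \<le> 1 + 1"
    unfolding sum.distrib by (intro add_mono sum_in_group_le[OF assms(1)]) auto
  finally show ?thesis by simp
qed

section \<open>Noisy ECDF and thresholds under the coupling\<close>

lemma noisy_ecdf_eq_sum:
  "noisy_ecdf M \<tau> L X w i =
     ((\<Sum>k<length X. of_bool (M (X ! k) \<le> \<tau> i)) +
      (\<Sum>l\<le>L. w (Eta (nat \<lceil>real i / 2 ^ l\<rceil>) l))) / real (length X)"
proof -
  have "{k. k < length X \<and> M (X ! k) \<le> \<tau> i} = {k \<in> {..<length X}. M (X ! k) \<le> \<tau> i}"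
    by auto
  then show ?thesis
    by (simp add: noisy_ecdf_def of_bool_def sum.inter_filter[symmetric] add_divide_distrib
        atLeast0AtMost)
qed

text \<open>Along the path from leaf \<open>i - 1\<close> to the root the shifts add up to the
  difference of the two suffix indicators, which is the change in the count at
  \<open>\<tau> i\<close>.\<close>

lemma noisy_ecdf_shift:
  assumes adj: "length X = length X'" "k0 < length X"
      "\<And>k. k < length X \<Longrightarrow> k \<noteq> k0 \<Longrightarrow> X ! k = X' ! k"
    and i: "i \<in> {1..N}" and N: "N \<le> 2 ^ L"
    and a: "M (X ! k0) \<le> \<tau> i \<longleftrightarrow> a \<le> i - 1" and a': "M (X' ! k0) \<le> \<tau> i \<longleftrightarrow> a' \<le> i - 1"
    and \<delta>: "\<And>i. i < 2 ^ L \<Longrightarrow> (\<Sum>l\<le>L. \<delta> l (i div 2 ^ l)) = of_bool (a \<le> i)"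
    and \<delta>': "\<And>i. i < 2 ^ L \<Longrightarrow> (\<Sum>l\<le>L. \<delta>' l (i div 2 ^ l)) = of_bool (a' \<le> i)"
    and d: "\<And>j l. d (Eta (Suc j) l) = \<delta> l j - \<delta>' l j"
  shows "noisy_ecdf M \<tau> L X' (noise_shift (noise_labels L Q) d w) i = noisy_ecdf M \<tau> L X w i"
proof -
  let ?w = "noise_shift (noise_labels L Q) d w"
  have i': "i - 1 < 2 ^ L" using i N by auto
  have "?w (Eta (nat \<lceil>real i / 2 ^ l\<rceil>) l) = w (Eta (nat \<lceil>real i / 2 ^ l\<rceil>) l) +
      (\<delta> l ((i - 1) div 2 ^ l) - \<delta>' l ((i - 1) div 2 ^ l))" if l: "l \<le> L" for l
  proof -
    have "(i - 1) div 2 ^ l < 2 ^ (L - l)"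
      using i' l by (simp add: less_mult_imp_div_less flip: power_add)
    \<comment> \<open>\<open>noise_shift\<close> adds \<open>d\<close> only at labels of the index
      set.\<close>
    then have "Eta (Suc ((i - 1) div 2 ^ l)) l \<in> noise_labels L Q"
      using l by (auto simp: noise_labels_def)
    then show ?thesis
      using i d by (simp add: nat_ceiling_divide_power)
  qed
  then have noise: "(\<Sum>l\<le>L. ?w (Eta (nat \<lceil>real i / 2 ^ l\<rceil>) l)) =
      (\<Sum>l\<le>L. w (Eta (nat \<lceil>real i / 2 ^ l\<rceil>) l)) +
      (of_bool (a \<le> i - 1) - of_bool (a' \<le> i - 1))"
    by (simp add: sum.distrib sum_subtractf \<delta>[OF i'] \<delta>'[OF i'] del: One_nat_def)
  have "(\<Sum>k<length X'. of_bool (M (X' ! k) \<le> \<tau> i)) + (\<Sum>l\<le>L. ?w (Eta (nat \<lceil>real i / 2 ^ l\<rceil>) l)) =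
      (\<Sum>k<length X. of_bool (M (X ! k) \<le> \<tau> i)) + (\<Sum>l\<le>L. w (Eta (nat \<lceil>real i / 2 ^ l\<rceil>) l))"
    using noise adjacent_sum[OF adj, of "\<lambda>x. of_bool (M x \<le> \<tau> i)"] unfolding a a' by linarith
  then show ?thesis
    unfolding noisy_ecdf_eq_sum by (simp only: adj(1))
qed

text \<open>Bisection queries only grid points, so the thresholds are post-processing of the
  published ECDF values.\<close>

lemma threshold_cong:
  assumes inj: "inj_on \<tau> {1..N}" and "0 < \<psi>" and K: "K = (LEAST K. 1 / 2 ^ K \<le> \<psi>)"
    and grid: "\<And>k::nat. 0 < k \<Longrightarrow> k < 2 ^ K \<Longrightarrow> real k / 2 ^ K \<in> \<tau> ` {1..N}"
    and eq: "\<And>i. i \<in> {1..N} \<Longrightarrow> noisy_ecdf M \<tau> L X w i = noisy_ecdf M \<tau> L X' w' i"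
  shows "threshold M \<tau> N L Q \<psi> X w = threshold M \<tau> N L Q \<psi> X' w'"
proof -
  have "noisy_ecdf_at M \<tau> N L X w (real k / 2 ^ K) = noisy_ecdf_at M \<tau> N L X' w' (real k / 2 ^ K)"
    if "0 < k" "k < 2 ^ K" for k :: nat
    unfolding noisy_ecdf_at_def by (intro eq the_inv_into_into[OF inj grid[OF that]] order_refl)
  then show ?thesis
    by (auto simp: fun_eq_iff threshold_def bisection_eq_bisect_index[OF assms(2) K]
        intro: bisect_index_cong)
qed

text \<open>Between the fixed ends 0 and 1, the order comes from monotonicity of bisection in its
  target \<open>q / Q\<close>.\<close>

lemma threshold_mono:
  assumes "0 < \<psi>" "1 \<le> Q"
  shows "mono_on {0..Q} (threshold M \<tau> N L Q \<psi> X w)"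
proof (rule mono_onI)
  fix q r assume qr: "q \<in> {0..Q}" "r \<in> {0..Q}" "q \<le> r"
  define K where "K = (LEAST K. 1 / 2 ^ K \<le> \<psi>)"
  note bis = bisection_eq_bisect_index[OF assms(1) K_def]
  have bounds: "0 \<le> bisection \<psi> F p" "bisection \<psi> F p \<le> 1" for F p
  proof -
    have "real (Suc (bisect_index F p K)) \<le> real (2 ^ K)"
      using bisect_index_less[of F p K] by (intro of_nat_mono) simp
    then show "0 \<le> bisection \<psi> F p" "bisection \<psi> F p \<le> 1"
      unfolding bis by (auto simp: field_simps)
  qed
  have "bisection \<psi> F (real q / real Q) \<le> bisection \<psi> F (real r / real Q)" for F
    unfolding bis using qr(3) bisect_index_mono[of "real q / real Q" "real r / real Q" F K]
    by (simp add: divide_right_mono)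
  then show "threshold M \<tau> N L Q \<psi> X w q \<le> threshold M \<tau> N L Q \<psi> X w r"
    using qr assms(2) bounds by (auto simp: threshold_def)
qed

text \<open>Each threshold is 0, 1 or one of the \<open>2 ^ K\<close> midpoints of the final
  intervals; this finiteness allows the slicing of the output space.\<close>

lemma finite_thresholds:
  assumes "0 < \<psi>"
  shows "finite (range (\<lambda>w. restrict (threshold M \<tau> N L Q \<psi> X w) {0..Q}))"
proof -
  define K where "K = (LEAST K. 1 / 2 ^ K \<le> \<psi>)"
  let ?V = "{0, 1} \<union> (\<lambda>k. (2 * real k + 1) / 2 ^ Suc K) ` {..<2 ^ K}"
  have "threshold M \<tau> N L Q \<psi> X w q \<in> ?V" for w q
    unfolding threshold_def bisection_eq_bisect_index[OF assms K_def]
    using bisect_index_less by auto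
  then have "range (\<lambda>w. restrict (threshold M \<tau> N L Q \<psi> X w) {0..Q}) \<subseteq> {0..Q} \<rightarrow>\<^sub>E ?V"
    by (simp only: image_subset_iff restrict_PiE_iff) blast
  then show ?thesis
    by (rule finite_subset) (intro finite_PiE; simp)
qed

text \<open>Published threshold vectors are extensional, so equality with an extensional
  \<open>t\<close> is a finite conjunction of coordinate equations; for any other \<open>t\<close>
  the slice is empty.\<close>

lemma threshold_slice_measurable:
  "{z \<in> space (hl_output_space N Q). fst (snd z) = t} \<in> sets (hl_output_space N Q)"
proof -
  have ext: "fst (snd z) \<in> extensional {0..Q}" if "z \<in> space (hl_output_space N Q)" for z
    using that by (auto simp: hl_output_space_def space_pair_measure space_PiM PiE_def)
  show ?thesis
  proof (cases "t \<in> extensional {0..Q}")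
    case True
    then have "fst (snd z) = t \<longleftrightarrow> (\<forall>q\<in>{0..Q}. fst (snd z) q = t q)"
      if "z \<in> space (hl_output_space N Q)" for z
      using ext[OF that] by (auto intro: extensionalityI)
    then have "{z \<in> space (hl_output_space N Q). fst (snd z) = t} =
        {z \<in> space (hl_output_space N Q). \<forall>q\<in>{0..Q}. fst (snd z) q = t q}"
      by blast
    also have "\<dots> \<in> sets (hl_output_space N Q)"
      unfolding hl_output_space_def by measurable
    finally show ?thesis .
  next
    case False
    then have "{z \<in> space (hl_output_space N Q). fst (snd z) = t} = {}"
      using ext by blast
    then show ?thesis by (simp only: sets.empty_sets)
  qed
qed

text \<open>Each count label receives the contribution of \<open>x\<close> minus that of
  \<open>x'\<close> under fixed thresholds \<open>t\<close>, compensating for the replacement of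
  \<open>x\<close> by \<open>x'\<close>. In \<open>Eta\<close>, \<open>j - 1\<close> converts to
  positions counted from 0; this part does not depend on \<open>t\<close>.\<close>

definition coupling_shift ::
    "('x \<Rightarrow> real) \<Rightarrow> ('x \<Rightarrow> real) \<Rightarrow> (nat \<Rightarrow> nat \<Rightarrow> real) \<Rightarrow> 'x \<Rightarrow> 'x \<Rightarrow> (nat \<Rightarrow> real) \<Rightarrow>
     noise_label \<Rightarrow> real" where
  "coupling_shift M Y \<delta> x x' t v = (case v of
     Eta j l \<Rightarrow> \<delta> l (j - 1)
   | Xi s q \<Rightarrow> (if in_group M t q x then if s = 1 then M x else 1 - M x else 0) -
       (if in_group M t q x' then if s = 1 then M x' else 1 - M x' else 0)
   | Zeta s q \<Rightarrow> (if in_group M t q x then if s = 1 then Y x else 1 - Y x else 0) -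
       (if in_group M t q x' then if s = 1 then Y x' else 1 - Y x' else 0))"

text \<open>The shift is built from the published thresholds \<open>t\<close>, restricted to
  \<open>{0..Q}\<close>, while the counts use the unrestricted \<open>u\<close>; groups
  \<open>1\<close> to \<open>Q\<close> read only indices on which the two agree.\<close>

lemma counts_shift:
  assumes adj: "length X = length X'" "k0 < length X"
      "\<And>k. k < length X \<Longrightarrow> k \<noteq> k0 \<Longrightarrow> X ! k = X' ! k"
    and t: "\<And>q. q \<in> {0..Q} \<Longrightarrow> t q = u q" and sq: "s \<in> {0, 1}" "q \<in> {1..Q}"
    and w': "w' = noise_shift (noise_labels L Q) (coupling_shift M Y \<delta> (X ! k0) (X' ! k0) t) w"
  shows "predicted_count M u X' w' s q = predicted_count M u X w s q"
    and "observed_count M Y u X' w' s q = observed_count M Y u X w s q"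
proof -
  have labels: "Xi s q \<in> noise_labels L Q" "Zeta s q \<in> noise_labels L Q"
    using sq by (auto simp: noise_labels_def)
  have "in_group M t q x = in_group M u q x" for x
    using sq t[of 0] t[of q] t[of "q - 1"] by (auto simp: in_group_def)
  note * = this labels
  show "predicted_count M u X' w' s q = predicted_count M u X w s q"
    unfolding predicted_count_def sum_group[where f = "\<lambda>x. if s = 1 then M x else 1 - M x"]
    using adjacent_sum[OF adj, of "\<lambda>x. if in_group M u q x then if s = 1 then M x else 1 - M x else 0"]
    by (simp add: w' * coupling_shift_def)
  show "observed_count M Y u X' w' s q = observed_count M Y u X w s q"
    unfolding observed_count_def sum_group[where f = "\<lambda>x. if s = 1 then Y x else 1 - Y x"]
    using adjacent_sum[OF adj, of "\<lambda>x. if in_group M u q x then if s = 1 then Y x else 1 - Y x else 0"]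
    by (simp add: w' * coupling_shift_def)
qed

text \<open>The statistic is a function of the noisy counts, so publishing it needs no further
  shift.\<close>

lemma hl_output_cong:
  assumes "threshold M \<tau> N L Q \<psi> X w = t" "threshold M \<tau> N L Q \<psi> X' w' = t"
    and "\<And>i. i \<in> {1..N} \<Longrightarrow> noisy_ecdf M \<tau> L X w i = noisy_ecdf M \<tau> L X' w' i"
    and E: "\<And>s q. s \<in> {0, 1} \<Longrightarrow> q \<in> {1..Q} \<Longrightarrow> predicted_count M t X w s q = predicted_count M t X' w' s q"
    and Ob: "\<And>s q. s \<in> {0, 1} \<Longrightarrow> q \<in> {1..Q} \<Longrightarrow> observed_count M Y t X w s q = observed_count M Y t X' w' s q"
  shows "hl_output M Y \<tau> N L Q \<psi> X w = hl_output M Y \<tau> N L Q \<psi> X' w'"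
proof -
  have "hl_statistic Q (predicted_count M t X w) (observed_count M Y t X w) =
      hl_statistic Q (predicted_count M t X' w') (observed_count M Y t X' w')"
    unfolding hl_statistic_def using E Ob by (intro sum.cong) auto
  moreover have "(\<lambda>(s, q)\<in>{0, 1} \<times> {1..Q}. predicted_count M t X w s q) =
      (\<lambda>(s, q)\<in>{0, 1} \<times> {1..Q}. predicted_count M t X' w' s q)"
    "(\<lambda>(s, q)\<in>{0, 1} \<times> {1..Q}. observed_count M Y t X w s q) =
      (\<lambda>(s, q)\<in>{0, 1} \<times> {1..Q}. observed_count M Y t X' w' s q)"
    using E Ob by (auto intro!: restrict_ext)
  moreover have "(\<lambda>i\<in>{1..N}. noisy_ecdf M \<tau> L X w i) = (\<lambda>i\<in>{1..N}. noisy_ecdf M \<tau> L X' w' i)"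
    using assms(3) by (intro restrict_ext)
  ultimately show ?thesis
    unfolding hl_output_def assms(1,2) Let_def by simp
qed

theorem theorem2:
  fixes \<epsilon> \<epsilon>' \<psi> :: real
    and n N Q L K :: nat
    and M Y :: "'x \<Rightarrow> real"
    and \<tau> :: "nat \<Rightarrow> real"
  assumes "\<epsilon> > 0" and "n \<ge> 1" and "N \<ge> 1" and "Q \<ge> 1"
    and "L = nat \<lceil>log 2 (real N)\<rceil>"
    and "\<epsilon>' = \<epsilon> / (real L + 9)"
    and "\<And>x. M x \<in> {0..1}"
    and "\<And>x. Y x \<in> {0, 1}"
    and "0 < \<psi>" and "\<psi> < 1"
    and "strict_mono_on {1..N} \<tau>"
    and "\<tau> ` {1..N} \<subseteq> {0..1}"
    and "K = (LEAST K. 1 / 2 ^ K \<le> \<psi>)"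
    and "\<And>k::nat. 0 < k \<Longrightarrow> k < 2 ^ K \<Longrightarrow> real k / 2 ^ K \<in> \<tau> ` {1..N}"
  shows "differentially_private \<epsilon> {X. length X = n} adjacent (hl_output_space N Q)
           (private_hl M Y \<tau> N L Q \<psi> \<epsilon>')"
proof -
  have \<epsilon>': "0 < \<epsilon>'" using assms(1,6) by simp
  note meas = measurable_hl_output[OF assms(9)]
  have N: "N \<le> 2 ^ L"
  proof -
    have "log 2 (real N) \<le> real L"
      unfolding assms(5) by linarith
    then have "real N \<le> 2 powr real L"
      using assms(3) by (simp add: log_le_iff)
    then have "real N \<le> real (2 ^ L)"
      by (simp add: powr_realpow)
    then show ?thesis by (simp only: of_nat_le_iff)
  qed
  have Y: "\<And>x. Y x \<in> {0..1}"
    using assms(8) by (metis atLeastAtMost_iff insert_iff order_refl singletonD zero_le_one)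
  have "prob_space (private_hl M Y \<tau> N L Q \<psi> \<epsilon>' X)" for X
    unfolding private_hl_def noise_measure_def
    using \<epsilon>' meas[unfolded noise_measure_def]
    by (intro prob_space.prob_space_distr prob_space_PiM_laplace) auto
  moreover have "sets (private_hl M Y \<tau> N L Q \<psi> \<epsilon>' X) = sets (hl_output_space N Q)" for X
    by (simp add: private_hl_def)
  moreover have "measure (private_hl M Y \<tau> N L Q \<psi> \<epsilon>' X) S \<le>
      exp \<epsilon> * measure (private_hl M Y \<tau> N L Q \<psi> \<epsilon>' X') S"
    if adj: "adjacent X X'" and S: "S \<in> sets (hl_output_space N Q)" for X X' S
  proof -
    obtain k0 where k0: "length X = length X'" "k0 < length X"
        "\<And>k. k < length X \<Longrightarrow> k \<noteq> k0 \<Longrightarrow> X ! k = X' ! k"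
      using adj unfolding adjacent_def by blast
    obtain a where a: "a \<le> N" "\<And>i. i \<in> {1..N} \<Longrightarrow> (M (X ! k0) \<le> \<tau> i \<longleftrightarrow> a \<le> i - 1)"
      using threshold_indicator_eq_suffix[OF assms(11)] by blast
    obtain a' where a': "a' \<le> N" "\<And>i. i \<in> {1..N} \<Longrightarrow> (M (X' ! k0) \<le> \<tau> i \<longleftrightarrow> a' \<le> i - 1)"
      using threshold_indicator_eq_suffix[OF assms(11)] by blast
    have decomp: "\<exists>\<delta> :: nat \<Rightarrow> nat \<Rightarrow> real.
        (\<forall>i<2 ^ L. (\<Sum>l\<le>L. \<delta> l (i div 2 ^ l)) = of_bool (c \<le> i)) \<and>
        (\<Sum>l\<le>L. \<Sum>j<2 ^ (L - l). \<bar>\<delta> l j\<bar>) \<le> (real L + 3) / 2" if "c \<le> N" for c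
    proof -
      have "(if even c then real L + 2 else real L + 3) / 2 \<le> (real L + 3) / 2"
        by simp
      then show ?thesis
        using suffix_dyadic_decomposition[OF order_trans[OF that N]] order_trans by blast
    qed
    obtain \<delta> where \<delta>: "\<And>i. i < 2 ^ L \<Longrightarrow> (\<Sum>l\<le>L. \<delta> l (i div 2 ^ l)) = of_bool (a \<le> i)"
        "(\<Sum>l\<le>L. \<Sum>j<2 ^ (L - l). \<bar>\<delta> l j\<bar>) \<le> (real L + 3) / 2"
      using decomp[OF a(1)] by blast
    obtain \<delta>' where \<delta>': "\<And>i. i < 2 ^ L \<Longrightarrow> (\<Sum>l\<le>L. \<delta>' l (i div 2 ^ l)) = of_bool (a' \<le> i)"
        "(\<Sum>l\<le>L. \<Sum>j<2 ^ (L - l). \<bar>\<delta>' l j\<bar>) \<le> (real L + 3) / 2"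
      using decomp[OF a'(1)] by blast
    define d where "d = coupling_shift M Y (\<lambda>l j. \<delta> l j - \<delta>' l j) (X ! k0) (X' ! k0)"
    define T where "T = range (\<lambda>w. restrict (threshold M \<tau> N L Q \<psi> X w) {0..Q})"
    have tag: "fst (snd (hl_output M Y \<tau> N L Q \<psi> X w)) = restrict (threshold M \<tau> N L Q \<psi> X w) {0..Q}" for w
      by (simp add: hl_output_def Let_def)
    have couple: "hl_output M Y \<tau> N L Q \<psi> X' (noise_shift (noise_labels L Q) (d t) w) = hl_output M Y \<tau> N L Q \<psi> X w"
      if t: "t = restrict (threshold M \<tau> N L Q \<psi> X w) {0..Q}" for t w
    proof -
      have ecdf: "noisy_ecdf M \<tau> L X' (noise_shift (noise_labels L Q) (d t) w) i = noisy_ecdf M \<tau> L X w i"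
        if "i \<in> {1..N}" for i
        by (rule noisy_ecdf_shift[where M = M and \<tau> = \<tau> and \<delta> = \<delta> and \<delta>' = \<delta>', OF k0 that N a(2)[OF that] a'(2)[OF that] \<delta>(1) \<delta>'(1)])
           (simp_all add: d_def coupling_shift_def)
      \<comment> \<open>The tree shift already equalizes the ECDFs, so both runs have the same
        thresholds; only then can the counts be compared group by group.\<close>
      have "threshold M \<tau> N L Q \<psi> X' (noise_shift (noise_labels L Q) (d t) w) = threshold M \<tau> N L Q \<psi> X w"
        using strict_mono_on_imp_inj_on[OF assms(11)] assms(9,13,14) ecdf by (rule threshold_cong)
      then show ?thesis
        using t ecdf unfolding d_def by (intro hl_output_cong[OF _ refl] counts_shift[OF k0]) auto
    qed
    have cost: "(\<Sum>v\<in>noise_labels L Q. \<bar>d t v\<bar>) / (1 / \<epsilon>') \<le> \<epsilon>" if "t \<in> T" for t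
    proof -
      have mono: "mono_on {0..Q} t"
      proof (rule mono_onI)
        fix q r assume qr: "q \<in> {0..Q}" "r \<in> {0..Q}" "q \<le> r"
        obtain w where "t = restrict (threshold M \<tau> N L Q \<psi> X w) {0..Q}"
          using \<open>t \<in> T\<close> unfolding T_def by blast
        then show "t q \<le> t r"
          using mono_onD[OF threshold_mono[OF assms(9,4)] qr] qr by simp
      qed
      have "(\<Sum>l\<le>L. \<Sum>j<2 ^ (L - l). \<bar>\<delta> l j - \<delta>' l j\<bar>)
          \<le> (\<Sum>l\<le>L. \<Sum>j<2 ^ (L - l). \<bar>\<delta> l j\<bar> + \<bar>\<delta>' l j\<bar>)"
        by (intro sum_mono abs_triangle_ineq4)
      also have "\<dots> \<le> (real L + 3) / 2 + (real L + 3) / 2"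
        unfolding sum.distrib by (intro add_mono \<delta>(2) \<delta>'(2))
      finally have "(\<Sum>l\<le>L. \<Sum>j<2 ^ (L - l). \<bar>\<delta> l j - \<delta>' l j\<bar>) \<le> real L + 3"
        by simp
      \<comment> \<open>The three terms are the costs of the tree noise, the predicted counts and
        the observed counts.\<close>
      then have "(\<Sum>v\<in>noise_labels L Q. \<bar>d t v\<bar>) \<le> (real L + 3) + 2 + 2"
        unfolding sum_noise_labels d_def coupling_shift_def noise_label.case diff_Suc_1
        by (intro add_mono group_count_shift_le[OF mono] assms(7) Y)
      then have "(\<Sum>v\<in>noise_labels L Q. \<bar>d t v\<bar>) * \<epsilon>' \<le> (real L + 9) * \<epsilon>'"
        using \<epsilon>' by (intro mult_right_mono) auto
      then show ?thesis by (simp add: assms(6))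
    qed
    show ?thesis
      unfolding private_hl_def noise_measure_def
    proof (rule measure_distr_le_if_shift_coupling[where T = T and tag = "\<lambda>z. fst (snd z)" and d = d])
      show "finite T" unfolding T_def by (rule finite_thresholds[OF assms(9)])
      show "finite (noise_labels L Q)" by (rule finite_noise_labels)
      show "0 < 1 / \<epsilon>'" using \<epsilon>' by simp
      show "hl_output M Y \<tau> N L Q \<psi> X \<in> Pi\<^sub>M (noise_labels L Q) (\<lambda>_. laplace (1 / \<epsilon>')) \<rightarrow>\<^sub>M hl_output_space N Q"
        "hl_output M Y \<tau> N L Q \<psi> X' \<in> Pi\<^sub>M (noise_labels L Q) (\<lambda>_. laplace (1 / \<epsilon>')) \<rightarrow>\<^sub>M hl_output_space N Q"
        by (rule meas[unfolded noise_measure_def])+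
      show "fst (snd (hl_output M Y \<tau> N L Q \<psi> X w)) \<in> T" for w
        unfolding tag T_def by (rule rangeI)
      show "{z \<in> space (hl_output_space N Q). fst (snd z) = t} \<in> sets (hl_output_space N Q)" for t
        by (rule threshold_slice_measurable)
      show "hl_output M Y \<tau> N L Q \<psi> X' (noise_shift (noise_labels L Q) (d t) w) = hl_output M Y \<tau> N L Q \<psi> X w"
        if "fst (snd (hl_output M Y \<tau> N L Q \<psi> X w)) = t" for t w
        by (rule couple) (simp only: that[symmetric] tag)
      show "(\<Sum>v\<in>noise_labels L Q. \<bar>d t v\<bar>) / (1 / \<epsilon>') \<le> \<epsilon>" if "t \<in> T" for t
        using that by (rule cost)
      show "S \<in> sets (hl_output_space N Q)" by (rule S)
    qed
  qed
  ultimately show ?thesis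
    unfolding differentially_private_def by (intro conjI ballI impI)
qed

end
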